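(* Let $x\prec y$ be a covering in a modular lattice $L$. Then $\upsilon[x\prec y]\le\upsilon[\mathrm{Fg}\{x\}\prec\mathrm{Fg}\{y\}]$ (the left side computed in $L$, the right side in $\mathrm{Fil}\,L$), with equality if $\upsilon[x\prec y]$ is finite or countable. In any case, if $\upsilon[x\prec y]$ is infinite then $\upsilon[\mathrm{Fg}\{x\}\prec\mathrm{Fg}\{y\}]$ is infinite.
   Context: A covering $x\prec y$ in a lattice is a pair $x<y$ with no element strictly between. For pairs with $x\le y$, $z\le w$, write $\langle x,y\rangle\nearrow\langle z,w\rangle$ if $y\wedge z=x$ and $y\vee z=w$; projective equivalence $\sim$ is the symmetric and transitive closure of $\nearrow$. For a chain $C$ in a modular lattice $M$ and a covering $x\prec y$ of $M$, $\mu_C[x\prec y]$ is the cardinality of the set of coverings $u\prec v$ of $M$ with $u,v\in C$ and $\langle u,v\rangle\sim\langle x,y\rangle$. The multiplicity upper bound $\upsilon[x\prec y]$ of $x\prec y$ in $M$ is the least cardinal $\nu$ such that $\mu_C[x\prec y]<\nu$ for every chain $C$ in $M$. A filter of $L$ is a nonempty up-closed subset closed under binary meets. $\mathrm{Fil}\,L$ is the lattice of filters ordered by reverse inclusion ($F\le G$ iff $G\subseteq F$); it is modular if $L$ is. $\mathrm{Fg}\{x\}=\{z\in L: z\ge x\}$ is the principal filter of $x$; $x\mapsto\mathrm{Fg}\{x\}$ is a lattice embedding of $L$ into $\mathrm{Fil}\,L$, and for $L$ modular it takes coverings to coverings. *)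

theory Defs
  imports Main
begin

unbundle cardinal_syntax

class modular_lattice = lattice +
  assumes modular: "x \<le> z \<Longrightarrow> sup x (inf y z) = inf (sup x y) z"

definition covered_by :: "'a::order \<Rightarrow> 'a \<Rightarrow> bool" (infix \<open>\<prec>\<close> 50)
  where "x \<prec> y \<longleftrightarrow> x < y \<and> (\<nexists>z. x < z \<and> z < y)"

definition transposes_up :: "'a::lattice \<times> 'a \<Rightarrow> 'a \<times> 'a \<Rightarrow> bool" (infix \<open>\<nearrow>\<close> 50)
  where "p \<nearrow> q \<longleftrightarrow>
    fst p \<le> snd p \<and> fst q \<le> snd q \<and>
    inf (snd p) (fst q) = fst p \<and> sup (snd p) (fst q) = snd q"

definition projective :: "'a::lattice \<times> 'a \<Rightarrow> 'a \<times> 'a \<Rightarrow> bool"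
  where "projective = (symclp (\<nearrow>))\<^sup>+\<^sup>+"

definition multiplicity :: "'a::lattice set \<Rightarrow> 'a \<Rightarrow> 'a \<Rightarrow> ('a \<times> 'a) rel"
  where "multiplicity C x y =
    |{(u, v). u \<in> C \<and> v \<in> C \<and> u \<prec> v \<and> projective (u, v) (x, y)}|"

definition bounds_multiplicity :: "'a::lattice \<Rightarrow> 'a \<Rightarrow> 'k rel \<Rightarrow> bool"
  where "bounds_multiplicity x y \<nu> \<longleftrightarrow>
    (\<forall>C. Complete_Partial_Order.chain (\<le>) C \<longrightarrow> multiplicity C x y <o \<nu>)"

text \<open>
  A cardinal is a relation satisfying \<^const>\<open>Card_order\<close>, up to \<^const>\<open>ordIso\<close>.  Least
  here means least among the cardinals on the type \<^typ>\<open>('a \<times> 'a) set\<close>, which is large enough to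
  have a bounding one; the lemma \<open>mult_upper_bound_ordLeq_iff\<close> below shows that
  the cardinal chosen is least among the bounding cardinals on every type.
\<close>

definition mult_upper_bound :: "'a::lattice \<Rightarrow> 'a \<Rightarrow> ('a \<times> 'a) set rel"
  where "mult_upper_bound x y =
    (SOME \<nu>. Card_order \<nu> \<and> bounds_multiplicity x y \<nu> \<and>
      (\<forall>\<kappa> :: ('a \<times> 'a) set rel. Card_order \<kappa> \<and> bounds_multiplicity x y \<kappa> \<longrightarrow> \<nu> \<le>o \<kappa>))"

lemma mult_upper_bound_props:
  fixes x y :: "'a::lattice"
  shows "Card_order (mult_upper_bound x y) \<and> bounds_multiplicity x y (mult_upper_bound x y) \<and>
    (\<forall>\<kappa> :: ('a \<times> 'a) set rel. Card_order \<kappa> \<and> bounds_multiplicity x y \<kappa> \<longrightarrow>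
      mult_upper_bound x y \<le>o \<kappa>)"
proof -
  let ?Q = "{\<nu> :: ('a \<times> 'a) set rel. Card_order \<nu> \<and> bounds_multiplicity x y \<nu>}"
  let ?s = "cardSuc |UNIV :: ('a \<times> 'a) set|"
  have "multiplicity C x y <o ?s" for C
    unfolding multiplicity_def
    by (rule ordLeq_ordLess_trans[OF card_of_mono1[OF subset_UNIV] cardSuc_greater[OF card_of_Card_order]])
  then have "?s \<in> ?Q"
    by (simp add: bounds_multiplicity_def cardSuc_Card_order[OF card_of_Card_order])
  then obtain \<nu> where \<nu>: "\<nu> \<in> ?Q" "\<And>\<kappa>. (\<kappa>, \<nu>) \<in> ordLess \<Longrightarrow> \<kappa> \<notin> ?Q"
    using wfE_min[OF wf_ordLess, of ?s ?Q] by blast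
  have "\<nu> \<le>o \<kappa>" if "\<kappa> \<in> ?Q" for \<kappa>
    using that \<nu> ordLess_or_ordLeq[of \<kappa> \<nu>] by (auto simp: card_order_on_def)
  with \<nu>(1) have "\<exists>\<nu> :: ('a \<times> 'a) set rel. Card_order \<nu> \<and> bounds_multiplicity x y \<nu> \<and>
      (\<forall>\<kappa> :: ('a \<times> 'a) set rel. Card_order \<kappa> \<and> bounds_multiplicity x y \<kappa> \<longrightarrow> \<nu> \<le>o \<kappa>)"
    by blast
  then show ?thesis
    unfolding mult_upper_bound_def by (rule someI_ex)
qed

lemma Card_order_mult_upper_bound: "Card_order (mult_upper_bound x y)"
  using mult_upper_bound_props by blast

lemma mult_upper_bound_ordLeq_iff:
  fixes \<kappa> :: "'k rel"
  assumes "Card_order \<kappa>"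
  shows "mult_upper_bound x y \<le>o \<kappa> \<longleftrightarrow> bounds_multiplicity x y \<kappa>"
proof
  assume "mult_upper_bound x y \<le>o \<kappa>"
  then show "bounds_multiplicity x y \<kappa>"
    using mult_upper_bound_props[of x y]
    by (auto simp: bounds_multiplicity_def intro: ordLess_ordLeq_trans)
next
  assume b: "bounds_multiplicity x y \<kappa>"
  let ?\<nu> = "mult_upper_bound x y"
  have wo: "Well_order \<kappa>" "Well_order ?\<nu>"
    using assms Card_order_mult_upper_bound by (auto simp: card_order_on_def)
  show "?\<nu> \<le>o \<kappa>"
  proof (rule ccontr)
    assume "\<not> ?\<nu> \<le>o \<kappa>"
    then have less: "\<kappa> <o ?\<nu>"
      using wo ordLess_or_ordLeq by blast
    then have "|Field \<kappa>| \<le>o |Field ?\<nu>|"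
      by (simp add: card_of_mono2 ordLess_imp_ordLeq)
    then obtain f where f: "inj_on f (Field \<kappa>)" "f ` Field \<kappa> \<subseteq> Field ?\<nu>"
      using card_of_ordLeq by metis
    let ?k = "|f ` Field \<kappa>|"
    have iso: "\<kappa> =o ?k"
      using card_of_Field_ordIso[OF assms] f(1)
      by (meson card_of_ordIsoI inj_on_imp_bij_betw ordIso_symmetric ordIso_transitive)
    then have "bounds_multiplicity x y ?k"
      using b by (auto simp: bounds_multiplicity_def intro: ordLess_ordIso_trans)
    then have "?\<nu> \<le>o ?k"
      using mult_upper_bound_props card_of_Card_order by blast
    then have "?\<nu> \<le>o \<kappa>"
      using iso ordIso_symmetric ordLeq_ordIso_trans by blast
    with \<open>\<not> ?\<nu> \<le>o \<kappa>\<close> show False by blast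
  qed
qed

definition is_lfilter :: "'a::lattice set \<Rightarrow> bool"
  where "is_lfilter F \<longleftrightarrow>
    F \<noteq> {} \<and> (\<forall>a\<in>F. \<forall>b. a \<le> b \<longrightarrow> b \<in> F) \<and> (\<forall>a\<in>F. \<forall>b\<in>F. inf a b \<in> F)"

typedef (overloaded) 'a lfilter = "{F :: 'a::lattice set. is_lfilter F}"
  morphisms set_of_lfilter Abs_lfilter
  by (rule exI[of _ UNIV]) (simp add: is_lfilter_def)

setup_lifting type_definition_lfilter

text \<open>
  The order is reverse inclusion, so the join is the intersection and
  the meet is the filter generated by the union.
\<close>

instantiation lfilter :: (lattice) lattice
begin

lift_definition less_eq_lfilter :: "'a lfilter \<Rightarrow> 'a lfilter \<Rightarrow> bool"
  is "\<lambda>F G. G \<subseteq> F" .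

lift_definition less_lfilter :: "'a lfilter \<Rightarrow> 'a lfilter \<Rightarrow> bool"
  is "\<lambda>F G. G \<subset> F" .

lift_definition sup_lfilter :: "'a lfilter \<Rightarrow> 'a lfilter \<Rightarrow> 'a lfilter"
  is "\<lambda>F G. F \<inter> G"
proof -
  fix F G :: "'a set"
  assume F: "is_lfilter F" and G: "is_lfilter G"
  then obtain a b where "a \<in> F" "b \<in> G" by (auto simp: is_lfilter_def)
  with F G have "sup a b \<in> F \<inter> G"
    unfolding is_lfilter_def by (meson IntI sup_ge1 sup_ge2)
  then have "F \<inter> G \<noteq> {}" by blast
  with F G show "is_lfilter (F \<inter> G)" unfolding is_lfilter_def by (metis Int_iff)
qed

lift_definition inf_lfilter :: "'a lfilter \<Rightarrow> 'a lfilter \<Rightarrow> 'a lfilter"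
  is "\<lambda>F G. {z. \<exists>a\<in>F. \<exists>b\<in>G. inf a b \<le> z}"
proof -
  fix F G :: "'a set"
  assume F: "is_lfilter F" and G: "is_lfilter G"
  let ?H = "{z. \<exists>a\<in>F. \<exists>b\<in>G. inf a b \<le> z}"
  have "?H \<noteq> {}" using F G by (fastforce simp: is_lfilter_def)
  moreover have "\<forall>z\<in>?H. \<forall>w. z \<le> w \<longrightarrow> w \<in> ?H" by (blast intro: order_trans)
  moreover have "inf z w \<in> ?H" if zw: "z \<in> ?H" "w \<in> ?H" for z w
  proof -
    from zw obtain a b c d where "a \<in> F" "b \<in> G" "inf a b \<le> z" "c \<in> F" "d \<in> G" "inf c d \<le> w"
      by blast
    moreover from this have "inf (inf a c) (inf b d) \<le> inf z w"
      by (metis inf_mono inf_assoc inf_left_commute)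
    ultimately show ?thesis using F G unfolding is_lfilter_def by blast
  qed
  ultimately show "is_lfilter ?H" unfolding is_lfilter_def by blast
qed

instance
proof
  fix F G H :: "'a lfilter"
  show "F < G \<longleftrightarrow> F \<le> G \<and> \<not> G \<le> F" by transfer auto
  show "F \<le> F" by transfer auto
  show "F \<le> G \<Longrightarrow> G \<le> H \<Longrightarrow> F \<le> H" by transfer auto
  show "F \<le> G \<Longrightarrow> G \<le> F \<Longrightarrow> F = G" by transfer auto
  show "inf F G \<le> F"
  proof transfer
    fix F G :: "'a set"
    assume "is_lfilter F" "is_lfilter G"
    then obtain a b where "a \<in> F" "b \<in> G" by (auto simp: is_lfilter_def)
    then show "F \<subseteq> {z. \<exists>a\<in>F. \<exists>b\<in>G. inf a b \<le> z}"
      using inf_le1 by blast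
  qed
  show "inf F G \<le> G"
  proof transfer
    fix F G :: "'a set"
    assume "is_lfilter F" "is_lfilter G"
    then obtain a b where "a \<in> F" "b \<in> G" by (auto simp: is_lfilter_def)
    then show "G \<subseteq> {z. \<exists>a\<in>F. \<exists>b\<in>G. inf a b \<le> z}"
      using inf_le2 by blast
  qed
  show "F \<le> G \<Longrightarrow> F \<le> H \<Longrightarrow> F \<le> inf G H"
  proof transfer
    fix F G H :: "'a set"
    assume F: "is_lfilter F" and "G \<subseteq> F" "H \<subseteq> F"
    then have "inf a b \<in> F" if "a \<in> G" "b \<in> H" for a b
      using that unfolding is_lfilter_def by blast
    then show "{z. \<exists>a\<in>G. \<exists>b\<in>H. inf a b \<le> z} \<subseteq> F"
      using F unfolding is_lfilter_def by blast
  qed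
  show "F \<le> sup F G" by transfer auto
  show "G \<le> sup F G" by transfer auto
  show "F \<le> H \<Longrightarrow> G \<le> H \<Longrightarrow> sup F G \<le> H" by transfer auto
qed

end

lift_definition Fg :: "'a::lattice \<Rightarrow> 'a lfilter" is "\<lambda>x. {z. x \<le> z}"
  by (auto simp: is_lfilter_def)

instance lfilter :: (modular_lattice) modular_lattice
proof
  fix F G H :: "'a lfilter"
  assume FH: "F \<le> H"
  have "sup F (inf G H) \<le> inf (sup F G) H"
    using FH by (simp add: le_infI1 le_infI2)
  moreover have "inf (sup F G) H \<le> sup F (inf G H)"
    using FH
  proof transfer
    fix F G H :: "'a set"
    assume F: "is_lfilter F" and G: "is_lfilter G" and H: "is_lfilter H" and HF: "H \<subseteq> F"
    show "F \<inter> {z. \<exists>a\<in>G. \<exists>b\<in>H. inf a b \<le> z} \<subseteq> {z. \<exists>a\<in>F \<inter> G. \<exists>b\<in>H. inf a b \<le> z}"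
    proof clarify
      fix z g h assume z: "z \<in> F" and gh: "g \<in> G" "h \<in> H" "inf g h \<le> z"
      let ?f = "inf z h"
      have "?f \<in> F" using F HF z gh(2) unfolding is_lfilter_def by blast
      then have "sup ?f g \<in> F \<inter> G"
        using F G gh(1) unfolding is_lfilter_def by (meson IntI sup_ge1 sup_ge2)
      moreover have "inf (sup ?f g) h \<le> z"
        using modular[of ?f h g] gh(3) by (metis inf_le1 inf_le2 le_supI)
      ultimately show "\<exists>a\<in>F \<inter> G. \<exists>b\<in>H. inf a b \<le> z" using gh(2) by blast
    qed
  qed
  ultimately show "sup F (inf G H) = inf (sup F G) H" by (rule order_antisym)
qed

lemma Fg_le_iff: "Fg x \<le> Fg y \<longleftrightarrow> x \<le> y"
  by transfer (auto intro: order_trans)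

lemma Fg_less_iff: "Fg x < Fg y \<longleftrightarrow> x < y"
  by (simp add: less_le_not_le Fg_le_iff)

lemma Fg_inf: "Fg (inf x y) = inf (Fg x) (Fg y)"
  by transfer (auto intro: order_trans inf_mono)

lemma Fg_sup: "Fg (sup x y) = sup (Fg x) (Fg y)"
  by transfer auto

lemma set_of_lfilter_props: "is_lfilter (set_of_lfilter F)"
  using set_of_lfilter by blast

lemma Fg_covered_by:
  fixes x y :: "'a::lattice"
  assumes "x \<prec> y"
  shows "Fg x \<prec> Fg y"
proof -
  have False if less: "Fg x < F" "F < Fg y" for F
  proof -
    note F = set_of_lfilter_props[of F, unfolded is_lfilter_def]
    from less have sub: "set_of_lfilter F \<subset> {z. x \<le> z}" "{z. y \<le> z} \<subset> set_of_lfilter F"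
      by (simp_all add: less_lfilter.rep_eq Fg.rep_eq)
    then obtain a where a: "a \<in> set_of_lfilter F" "\<not> y \<le> a" "x \<le> a" by blast
    have "y \<in> set_of_lfilter F" using sub by blast
    then have "inf a y \<in> set_of_lfilter F" using F a by blast
    moreover have "inf a y = x"
    proof (rule ccontr)
      assume "inf a y \<noteq> x"
      moreover have "x \<le> inf a y" using a(3) assms by (simp add: covered_by_def less_imp_le)
      moreover have "inf a y \<noteq> y" using a(2) by (metis inf_le1)
      moreover have "inf a y \<le> y" by simp
      ultimately have "x < inf a y" "inf a y < y" by (auto simp: less_le)
      with assms show False unfolding covered_by_def by blast
    qed
    ultimately have "x \<in> set_of_lfilter F" by simp
    then have "{z. x \<le> z} \<subseteq> set_of_lfilter F" using F by blast
    with sub show False by blast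
  qed
  with assms show ?thesis by (auto simp: covered_by_def Fg_less_iff)
qed

end

theory Submission
  imports Defs
begin

text \<open>
  The embedding \<^term>\<open>Fg\<close> carries chains to chains, which gives the inequality.  Conversely,
  every pair of filters projective to \<^term>\<open>(Fg x, Fg y)\<close> transposes up to some
  \<^term>\<open>(Fg u, Fg v)\<close> with \<^term>\<open>u \<prec> v\<close> projective to \<^term>\<open>x \<prec> y\<close> in the lattice, and
  \<^term>\<open>v\<close> can be taken below any given member of the upper filter.  Hence finitely many coverings in
  a chain of filters can be replaced by principal ones, working from the top down; the same works
  for an infinite descending family.  For a well-ordered infinite family, join with a principal
  filter \<^term>\<open>Fg v\<close>.  If this leaves infinitely many of the coverings intact, and \<^term>\<open>v\<close> can
  always be replaced by such an element above a further covering, an ascending chain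
  results.  Otherwise joining with any member of a certain filter collapses all but finitely many of
  the coverings, so meeting with it keeps the others, and a descending chain can be built inside
  that filter.
\<close>

section \<open>Transposition in modular lattices\<close>

lemma transposes_up_iff:
  "(a, b) \<nearrow> (c, d) \<longleftrightarrow> a \<le> b \<and> c \<le> d \<and> inf b c = a \<and> sup b c = d"
  by (simp add: transposes_up_def)

lemma transposes_up_refl: "a \<le> b \<Longrightarrow> (a, b) \<nearrow> (a, b)"
  by (simp add: transposes_up_iff inf.absorb2 sup.absorb1)

lemma transposes_up_trans:
  assumes "(a, b) \<nearrow> (c, d)" "(c, d) \<nearrow> (e, f)"
  shows "(a, b) \<nearrow> (e, f)"
proof -
  have *: "a \<le> b" "e \<le> f" "inf b c = a" "sup b c = d" "inf d e = c" "sup d e = f"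
    using assms by (auto simp: transposes_up_iff)
  have "inf b e = inf b (inf d e)"
    using *(4) by (metis inf_assoc inf_sup_absorb)
  moreover have "sup b e = sup (sup b c) e"
    using *(5) by (metis inf_sup_ord(2) sup.absorb2 sup_assoc)
  ultimately show ?thesis
    using * by (simp add: transposes_up_iff)
qed

text \<open>An element \<open>z\<close> strictly between \<open>a\<close> and \<open>b\<close> would
  put \<open>sup z c\<close> strictly between \<open>c\<close> and \<open>d\<close>: it is not
  \<open>c\<close> because \<open>inf b c = a\<close>, and not \<open>d\<close> because the modular
  law recovers \<open>z\<close> as \<open>inf (sup z c) b\<close>.\<close>

lemma covered_by_transposes_down:
  fixes a b c d :: "'a::modular_lattice"
  assumes t: "(a, b) \<nearrow> (c, d)" and "c \<prec> d"
  shows "a \<prec> b"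
proof -
  have *: "a \<le> b" "inf b c = a" "sup b c = d"
    using t by (auto simp: transposes_up_iff)
  have "c < d" and no: "\<And>z. c < z \<Longrightarrow> z < d \<Longrightarrow> False"
    using \<open>c \<prec> d\<close> by (auto simp: covered_by_def)
  have "a \<noteq> b"
    using * \<open>c < d\<close> by (metis inf.absorb_iff1 less_irrefl sup.absorb2)
  moreover have False if z: "a < z" "z < b" for z
  proof -
    have "sup z c \<noteq> c"
      using z * by (metis le_inf_iff less_le_not_le sup.absorb_iff2)
    then have "c < sup z c" by (simp add: less_le)
    moreover have "sup z c \<noteq> d"
    proof
      assume "sup z c = d"
      then have "sup z (inf c b) = b"
        using modular[of z b c] z * by (metis inf.absorb2 less_imp_le sup_ge1)
      then show False using z * by (metis inf_commute less_imp_le less_irrefl sup.absorb1)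
    qed
    moreover have "sup z c \<le> d"
      using z *(3) by (metis less_imp_le sup_mono order_refl)
    ultimately show False using no[of "sup z c"] by (simp add: less_le)
  qed
  ultimately show ?thesis using * by (auto simp: covered_by_def less_le)
qed

lemma covered_by_transposes_up:
  fixes a b c d :: "'a::modular_lattice"
  assumes t: "(a, b) \<nearrow> (c, d)" and "a \<prec> b"
  shows "c \<prec> d"
proof -
  have *: "c \<le> d" "inf b c = a" "sup b c = d"
    using t by (auto simp: transposes_up_iff)
  have "a < b" and no: "\<And>z. a < z \<Longrightarrow> z < b \<Longrightarrow> False"
    using \<open>a \<prec> b\<close> by (auto simp: covered_by_def)
  have "c \<noteq> d"
    using * \<open>a < b\<close> by (metis inf.absorb1 less_irrefl sup_ge1)
  moreover have False if z: "c < z" "z < d" for z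
  proof -
    have "inf b z \<noteq> b"
      using z * by (metis inf.absorb_iff1 le_sup_iff less_le_not_le)
    then have "inf b z < b" by (simp add: less_le)
    moreover have "inf b z \<noteq> a"
    proof
      assume "inf b z = a"
      then have "sup c a = z"
        using modular[of c z b] z * by (metis inf.absorb2 less_imp_le sup_commute)
      then show False using z * by (metis inf_le2 less_irrefl sup.absorb1)
    qed
    moreover have "a \<le> inf b z"
      using z *(2) by (metis less_imp_le inf_mono order_refl)
    ultimately show False using no[of "inf b z"] by (auto simp: less_le)
  qed
  ultimately show ?thesis using * by (auto simp: covered_by_def less_le)
qed

text \<open>By the modular law \<open>sup a (inf c b) = b\<close>. This is one half of a dichotomy:
  a pair collapsed by joining with \<open>c\<close> survives meeting with \<open>c\<close>.\<close>

lemma transposes_up_inf: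
  fixes a b c :: "'a::modular_lattice"
  assumes "a \<le> b" "sup a c = sup b c"
  shows "(inf a c, inf b c) \<nearrow> (a, b)"
proof -
  have "sup a (inf c b) = inf (sup a c) b" by (rule modular[OF assms(1)])
  also have "\<dots> = b" by (simp add: assms(2) inf.absorb2)
  finally have "sup (inf b c) a = b" by (simp add: ac_simps)
  moreover have "inf (inf b c) a = inf a c"
    using assms(1) by (metis inf.absorb1 inf_assoc inf_commute)
  ultimately show ?thesis
    using assms(1) by (simp add: transposes_up_iff inf.coboundedI1)
qed

text \<open>The other half of the dichotomy: \<open>inf b (sup a c)\<close> lies between
  \<open>a\<close> and \<open>b\<close>, and if it were \<open>b\<close> the two joins would agree,
  so it is \<open>a\<close>.\<close>

lemma covered_by_transposes_up_sup:
  assumes "a \<prec> b" "sup a c \<noteq> sup b c"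
  shows "(a, b) \<nearrow> (sup a c, sup b c)"
proof -
  have ab: "a < b" and no: "\<And>z. a < z \<Longrightarrow> z < b \<Longrightarrow> False"
    using assms by (auto simp: covered_by_def)
  have "inf b (sup a c) \<noteq> b"
  proof
    assume "inf b (sup a c) = b"
    then have "b \<le> sup a c" by (simp add: inf.absorb_iff1)
    then have "sup b c \<le> sup a c" by simp
    moreover have "sup a c \<le> sup b c" using ab by (simp add: le_supI1)
    ultimately show False using assms(2) by (simp add: order_antisym)
  qed
  then have "inf b (sup a c) < b" by (simp add: less_le)
  moreover have "a \<le> inf b (sup a c)" using ab by simp
  ultimately have "inf b (sup a c) = a"
    using no[of "inf b (sup a c)"] by (metis le_less)
  moreover have "sup b (sup a c) = sup b c"
    using ab by (metis less_imp_le sup.absorb1 sup_assoc)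
  ultimately show ?thesis
    using ab by (simp add: transposes_up_iff le_supI1)
qed

section \<open>Projectivity as a path of transpositions\<close>

lemma projective_refl: "a \<le> b \<Longrightarrow> projective (a, b) (a, b)"
  unfolding projective_def by (rule tranclp.r_into_trancl) (simp add: symclp_def transposes_up_refl)

lemma projective_up:
  assumes "p \<nearrow> q" "projective q r" shows "projective p r"
  using assms unfolding projective_def
  by (meson symclpI1 tranclp_into_tranclp2)

lemma projective_down:
  assumes "q \<nearrow> p" "projective q r" shows "projective p r"
  using assms unfolding projective_def
  by (meson symclpI2 tranclp_into_tranclp2)

lemma projective_induct [consumes 1, case_names refl up down]:
  assumes "projective p r"
    and r: "P r"
    and up: "\<And>p q. p \<nearrow> q \<Longrightarrow> P q \<Longrightarrow> P p"
    and down: "\<And>p q. q \<nearrow> p \<Longrightarrow> P q \<Longrightarrow> P p"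
  shows "P p"
  using assms(1) unfolding projective_def
  by (induction rule: converse_tranclp_induct) (use r up down in \<open>blast elim: symclpE\<close>)+

section \<open>Projectivity in the lattice of filters\<close>

text \<open>Turns membership into an inequality between filters, so that the later arguments need
  only lattice laws.\<close>

lemma in_set_of_lfilter_iff: "z \<in> set_of_lfilter F \<longleftrightarrow> F \<le> Fg z"
proof -
  have "is_lfilter (set_of_lfilter F)" by (rule set_of_lfilter_props)
  then show ?thesis
    by (auto simp: less_eq_lfilter.rep_eq Fg.rep_eq is_lfilter_def)
qed

lemma ex_Fg_ge: "\<exists>z. F \<le> Fg z"
  using set_of_lfilter_props[of F] by (auto simp: is_lfilter_def simp flip: in_set_of_lfilter_iff)

lemma inf_le_FgE:
  assumes "inf F G \<le> Fg z"
  obtains a b where "F \<le> Fg a" "G \<le> Fg b" "inf a b \<le> z"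
  using assms by (auto simp: inf_lfilter.rep_eq simp flip: in_set_of_lfilter_iff)

lemma Fg_transposes_up: "p \<nearrow> q \<Longrightarrow> map_prod Fg Fg p \<nearrow> map_prod Fg Fg q"
  by (cases p; cases q) (auto simp: transposes_up_iff Fg_le_iff simp flip: Fg_inf Fg_sup)

lemma Fg_projective:
  assumes "projective (u, v) (x, y)" "x \<le> y"
  shows "projective (Fg u, Fg v) (Fg x, Fg y)"
proof -
  have "projective (map_prod Fg Fg (u, v)) (Fg x, Fg y)"
    using assms(1)
  proof (induction rule: projective_induct)
    case refl
    show ?case using \<open>x \<le> y\<close> by (simp add: projective_refl Fg_le_iff)
  qed (use Fg_transposes_up projective_up projective_down in blast)+
  then show ?thesis by simp
qed

text \<open>Allows the principal pair above \<open>(F, G)\<close> to be moved down to a prescribed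
  member \<open>g\<close> of \<open>G\<close>. Since \<open>sup G (Fg u)\<close> is already
  \<open>Fg v\<close>, every such \<open>g\<close> satisfies \<open>sup g u = v\<close>; the modular
  law for filters gives the second claim.\<close>

lemma transposes_up_Fg_shrink:
  fixes F G :: "'a::modular_lattice lfilter"
  assumes t: "(F, G) \<nearrow> (Fg u, Fg v)" and g: "G \<le> Fg g" "g \<le> v"
  shows "(inf g u, g) \<nearrow> (u, v)" "(F, G) \<nearrow> (Fg (inf g u), Fg g)"
proof -
  have *: "F \<le> G" "Fg u \<le> Fg v" "inf G (Fg u) = F" "sup G (Fg u) = Fg v"
    using t by (auto simp: transposes_up_iff)
  have "Fg v \<le> Fg (sup g u)"
    unfolding *(4)[symmetric] Fg_sup using g(1) by (simp add: le_supI1)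
  then have gu: "sup g u = v"
    using g(2) *(2) by (simp add: Fg_le_iff order_antisym)
  then show "(inf g u, g) \<nearrow> (u, v)"
    using *(2) by (simp add: transposes_up_iff Fg_le_iff)
  have "inf G (Fg (inf g u)) = inf G (Fg u)"
    unfolding Fg_inf using g(1) by (metis inf.absorb1 inf_assoc)
  moreover have "sup G (inf (Fg u) (Fg g)) = inf (sup G (Fg u)) (Fg g)"
    by (rule modular[OF g(1)])
  then have "sup G (Fg (inf g u)) = Fg g"
    using g(2) *(4) by (simp add: Fg_inf Fg_le_iff inf.absorb1 inf_commute)
  ultimately show "(F, G) \<nearrow> (Fg (inf g u), Fg g)"
    using *(1,3) by (simp add: transposes_up_iff Fg_le_iff)
qed

text \<open>As \<open>inf G F' = F \<le> Fg u\<close>, some members of \<open>G\<close> and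
  \<open>F'\<close> have their meet below \<open>u\<close>. Adjusting them so that the meet is
  exactly \<open>inf g u\<close> mirrors the step from \<open>(F, G)\<close> to
  \<open>(F', G')\<close> by a step between elements.\<close>

lemma transposes_up_Fg_transfer:
  fixes F G F' G' :: "'a::modular_lattice lfilter"
  assumes t: "(F, G) \<nearrow> (Fg u, Fg v)" and t': "(F, G) \<nearrow> (F', G')"
  obtains a b c d where "(a, b) \<nearrow> (u, v)" "(a, b) \<nearrow> (c, d)" "(F', G') \<nearrow> (Fg c, Fg d)"
proof -
  have e: "F \<le> G" "inf G (Fg u) = F" "sup G (Fg u) = Fg v"
    and e': "F' \<le> G'" "inf G F' = F" "sup G F' = G'"
    using t t' by (auto simp: transposes_up_iff)
  have "inf G F' \<le> Fg u" using e(2) e'(2) by (metis inf_le2)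
  then obtain g0 f0 where g0: "G \<le> Fg g0" and f0: "F' \<le> Fg f0" and le: "inf g0 f0 \<le> u"
    by (rule inf_le_FgE)
  define g where "g = inf g0 v"
  have Gg: "G \<le> Fg g" and gv: "g \<le> v"
    using g0 by (auto simp: g_def Fg_inf simp flip: e(3))
  note sh = transposes_up_Fg_shrink[OF t Gg gv]
  let ?a = "inf g u"
  \<comment> \<open>Joining with \<open>?a\<close> makes \<open>inf g f\<close> equal to
    \<open>?a\<close> by the modular law, because \<open>inf f0 g \<le> ?a\<close>.\<close>
  define f where "f = sup ?a f0"
  have F'f: "F' \<le> Fg f"
    using f0 by (simp add: f_def Fg_sup le_supI2)
  have "inf g f0 \<le> inf g0 f0" unfolding g_def by (simp add: le_infI1)
  then have "inf g f0 \<le> u" using le by (rule order_trans)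
  then have "inf f0 g \<le> ?a" by (simp add: inf_commute)
  then have gf: "inf g f = ?a"
    using modular[of ?a g f0] by (simp add: f_def inf_commute sup.absorb1)
  have af: "?a \<le> f" by (simp add: f_def)
  have up: "(?a, g) \<nearrow> (f, sup g f)"
    using gf by (simp add: transposes_up_iff)
  have G_a: "sup G (Fg ?a) = Fg g" "inf G (Fg ?a) = F"
    using sh(2) by (auto simp: transposes_up_iff)
  have "sup G' (Fg f) = sup G (Fg f)"
    using e'(3) F'f by (metis sup.absorb2 sup_assoc)
  also have "\<dots> = sup (sup G (Fg ?a)) (Fg f)"
    using af by (metis Fg_le_iff sup.absorb2 sup_assoc)
  finally have s: "sup G' (Fg f) = Fg (sup g f)" by (simp add: G_a Fg_sup)
  have "inf G (Fg f) = inf G (inf (Fg g) (Fg f))"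
    using Gg by (metis inf.absorb1 inf_assoc)
  also have "\<dots> = F" using G_a(2) gf by (simp flip: Fg_inf)
  finally have "inf G (Fg f) = F" .
  \<comment> \<open>The modular law, applicable since \<open>F' \<le> Fg f\<close>, lifts the meet
    with \<open>Fg f\<close> from \<open>G\<close> to \<open>G'\<close>.\<close>
  then have "inf (sup F' G) (Fg f) = sup F' F"
    using modular[OF F'f, of G] by simp
  also have "\<dots> = F'" using e'(2) by (metis inf_le2 sup.absorb1)
  finally have "inf G' (Fg f) = F'" using e'(3) by (simp add: sup_commute)
  with s have "(F', G') \<nearrow> (Fg f, Fg (sup g f))"
    using e'(1) by (simp add: transposes_up_iff Fg_le_iff)
  with sh(1) up show ?thesis by (rule that)
qed

text \<open>The invariant along the path is that the current pair transposes up to a principal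
  covering. A step up composes by transitivity; a step down is absorbed by
  \<open>transposes_up_Fg_transfer\<close>.\<close>

lemma projective_Fg_principal:
  fixes x y w :: "'a::modular_lattice"
  assumes "x \<prec> y" and pr: "projective (F, G) (Fg x, Fg y)" and w: "G \<le> Fg w"
  obtains u v where "u \<prec> v" "projective (u, v) (x, y)" "(F, G) \<nearrow> (Fg u, Fg v)" "v \<le> w"
proof -
  let ?P = "\<lambda>p. \<exists>u v. u \<prec> v \<and> projective (u, v) (x, y) \<and> p \<nearrow> (Fg u, Fg v)"
  have xy: "x \<le> y" using \<open>x \<prec> y\<close> by (simp add: covered_by_def less_imp_le)
  have "?P (F, G)"
    using pr
  proof (induction rule: projective_induct)
    case refl
    show ?case
      using \<open>x \<prec> y\<close> xy projective_refl transposes_up_refl Fg_le_iff by blast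
  next
    case (up p q)
    then show ?case by (metis surj_pair transposes_up_trans)
  next
    case (down p q)
    obtain F G F' G' where [simp]: "q = (F, G)" "p = (F', G')" by (cases p; cases q) auto
    from down obtain u v where uv: "u \<prec> v" "projective (u, v) (x, y)" and "(F, G) \<nearrow> (Fg u, Fg v)"
      "(F, G) \<nearrow> (F', G')" by auto
    from this(3,4) obtain a b c d where
      "(a, b) \<nearrow> (u, v)" "(a, b) \<nearrow> (c, d)" "(F', G') \<nearrow> (Fg c, Fg d)"
      by (rule transposes_up_Fg_transfer)
    then have "c \<prec> d" "projective (c, d) (x, y)"
      using uv covered_by_transposes_up covered_by_transposes_down projective_up projective_down
      by blast+
    then show ?case using \<open>(F', G') \<nearrow> (Fg c, Fg d)\<close> by auto
  qed
  then obtain u v where uv: "u \<prec> v" "projective (u, v) (x, y)" and t: "(F, G) \<nearrow> (Fg u, Fg v)"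
    by blast
  \<comment> \<open>Shrinking to \<open>inf v w\<close>, again a member of \<open>G\<close>, brings
    the upper element below \<open>w\<close>.\<close>
  have "G \<le> Fg v" using t by (metis transposes_up_iff sup_ge1)
  then have "G \<le> Fg (inf v w)" using w by (simp add: Fg_inf)
  from transposes_up_Fg_shrink[OF t this inf_le1] show ?thesis
    using uv that covered_by_transposes_down projective_up inf_le2 by metis
qed

section \<open>Ladders of coverings\<close>

text \<open>Ladders stand for chains: they are the sets of coverings counted along a chain, and
  their subsets. Working with the pairs makes it possible to discard or replace single
  coverings.\<close>

definition covering_ladder :: "'a::lattice \<Rightarrow> 'a \<Rightarrow> ('a \<times> 'a) set \<Rightarrow> bool"
  where "covering_ladder x y Q \<longleftrightarrow>
    (\<forall>(u, v)\<in>Q. u \<prec> v \<and> projective (u, v) (x, y)) \<and>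
    (\<forall>(u, v)\<in>Q. \<forall>(u', v')\<in>Q. (u, v) = (u', v') \<or> v \<le> u' \<or> v' \<le> u)"

lemma covering_ladder_subset: "covering_ladder x y Q \<Longrightarrow> R \<subseteq> Q \<Longrightarrow> covering_ladder x y R"
  unfolding covering_ladder_def by blast

lemma covering_ladderD:
  assumes "covering_ladder x y Q" "(u, v) \<in> Q"
  shows "u \<prec> v" "projective (u, v) (x, y)"
  using assms unfolding covering_ladder_def by auto

lemma covering_ladder_linear:
  assumes "covering_ladder x y Q" "(u, v) \<in> Q" "(u', v') \<in> Q" "(u, v) \<noteq> (u', v')"
  shows "v \<le> u' \<or> v' \<le> u"
  using assms unfolding covering_ladder_def by blast

lemma covering_ladder_of_chain:
  assumes "Complete_Partial_Order.chain (\<le>) C"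
  shows "covering_ladder x y {(u, v). u \<in> C \<and> v \<in> C \<and> u \<prec> v \<and> projective (u, v) (x, y)}"
proof -
  have "(u, v) = (u', v') \<or> v \<le> u' \<or> v' \<le> u"
    if "u \<in> C" "v \<in> C" "u \<prec> v" "u' \<in> C" "v' \<in> C" "u' \<prec> v'" for u v u' v'
  proof (rule ccontr)
    assume n: "\<not> ?thesis"
    have lin: "a \<le> b \<or> b \<le> a" if "a \<in> C" "b \<in> C" for a b
      using assms that by (auto simp: chain_def)
    \<comment> \<open>The two intervals overlap, so distinct comparable lower ends would put one of
      them strictly inside a covering; likewise for the upper ends.\<close>
    have "u' < v" "u < v'"
      using n lin that by (metis le_less order_refl)+
    with that have "u = u'"
      using lin[of u u'] by (auto simp: covered_by_def le_less)
    moreover from this that have "v = v'"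
      using lin[of v v'] by (auto simp: covered_by_def le_less)
    ultimately show False using n by simp
  qed
  then show ?thesis unfolding covering_ladder_def by blast
qed

lemma chain_of_covering_ladder:
  assumes "covering_ladder x y Q"
  shows "Complete_Partial_Order.chain (\<le>) (fst ` Q \<union> snd ` Q)"
proof (rule chainI)
  fix a b assume "a \<in> fst ` Q \<union> snd ` Q" "b \<in> fst ` Q \<union> snd ` Q"
  then obtain u v u' v' where *: "(u, v) \<in> Q" "(u', v') \<in> Q" "a = u \<or> a = v" "b = u' \<or> b = v'"
    by auto
  then have "u \<le> v" "u' \<le> v'"
    using covering_ladderD(1)[OF assms] by (auto simp: covered_by_def less_imp_le)
  moreover from * covering_ladder_linear[OF assms *(1,2)]
  have "v \<le> u' \<or> v' \<le> u \<or> u = u' \<and> v = v'" by blast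
  ultimately show "a \<le> b \<or> b \<le> a"
    using *(3,4) by (elim disjE) (auto intro: order_trans)
qed

text \<open>The coverings counted along a chain form a ladder, and a ladder is contained in the set
  counted along the chain of its endpoints.\<close>

lemma bounds_multiplicity_iff_ladder:
  "bounds_multiplicity x y \<nu> \<longleftrightarrow> (\<forall>Q. covering_ladder x y Q \<longrightarrow> |Q| <o \<nu>)"
proof
  assume b: "bounds_multiplicity x y \<nu>"
  show "\<forall>Q. covering_ladder x y Q \<longrightarrow> |Q| <o \<nu>"
  proof (intro allI impI)
    fix Q assume Q: "covering_ladder x y Q"
    let ?C = "fst ` Q \<union> snd ` Q"
    have "Q \<subseteq> {(u, v). u \<in> ?C \<and> v \<in> ?C \<and> u \<prec> v \<and> projective (u, v) (x, y)}"
      using covering_ladderD[OF Q] by (force simp: image_iff)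
    then have "|Q| \<le>o multiplicity ?C x y"
      unfolding multiplicity_def by (rule card_of_mono1)
    moreover have "multiplicity ?C x y <o \<nu>"
      using b chain_of_covering_ladder[OF Q] by (simp add: bounds_multiplicity_def)
    ultimately show "|Q| <o \<nu>" by (rule ordLeq_ordLess_trans)
  qed
next
  assume "\<forall>Q. covering_ladder x y Q \<longrightarrow> |Q| <o \<nu>"
  then show "bounds_multiplicity x y \<nu>"
    unfolding bounds_multiplicity_def multiplicity_def using covering_ladder_of_chain by blast
qed

lemma Fg_covering_ladder:
  assumes Q: "covering_ladder x y Q" and "x \<le> y"
  shows "covering_ladder (Fg x) (Fg y) (map_prod Fg Fg ` Q)"
  using covering_ladderD[OF Q] covering_ladder_linear[OF Q] Fg_projective[OF _ \<open>x \<le> y\<close>]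
  unfolding covering_ladder_def by (fastforce simp: Fg_covered_by Fg_le_iff)

lemma inj_Fg: "inj Fg"
  by (rule injI) (metis Fg_le_iff order_antisym order_refl)

section \<open>Infinite ladders from sequences of coverings\<close>

lemma infinite_ladder_sequence:
  fixes u v :: "nat \<Rightarrow> 'a::lattice"
  assumes cov: "\<And>n. u n \<prec> v n" "\<And>n. projective (u n, v n) (x, y)"
    and lin: "\<And>m n. m < n \<Longrightarrow> v n \<le> u m \<or> v m \<le> u n"
  shows "\<exists>Q. covering_ladder x y Q \<and> infinite Q"
proof (intro exI conjI)
  let ?f = "\<lambda>n. (u n, v n)"
  have uv: "u n < v n" for n using cov by (simp add: covered_by_def)
  \<comment> \<open>If the pairs agreed, \<open>lin\<close> would give
    \<open>v n \<le> u n\<close>.\<close>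
  have "?f m \<noteq> ?f n" if "m < n" for m n
    using lin[OF that] uv[of m] uv[of n] by (auto simp: less_le_not_le)
  then have "m = n" if "?f m = ?f n" for m n
    using that by (cases m n rule: linorder_cases) metis+
  then have "inj ?f" by (rule injI)
  then show "infinite (range ?f)" using finite_imageD by blast
  have "?f m = ?f n \<or> v m \<le> u n \<or> v n \<le> u m" for m n
    using lin[of m n] lin[of n m] by (cases m n rule: linorder_cases) auto
  then show "covering_ladder x y (range ?f)"
    unfolding covering_ladder_def using cov by blast
qed

text \<open>Dependent choice: \<open>W\<close> records that the construction can go on below an
  element, and each new upper end is placed below the previous lower end.\<close>

lemma infinite_ladder_descending:
  assumes "W w"
    and step: "\<And>w. W w \<Longrightarrow> \<exists>u v. u \<prec> v \<and> projective (u, v) (x, y) \<and> v \<le> w \<and> W u"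
  shows "\<exists>Q. covering_ladder x y Q \<and> infinite Q"
proof -
  let ?P = "\<lambda>p. fst p \<prec> snd p \<and> projective p (x, y) \<and> W (fst p)"
  have "\<exists>f. \<forall>n. ?P (f n) \<and> snd (f (Suc n)) \<le> fst (f n)"
    by (rule dependent_nat_choice) (use step \<open>W w\<close> in \<open>fastforce+\<close>)
  then obtain f where f: "\<And>n. ?P (f n)" "\<And>n. snd (f (Suc n)) \<le> fst (f n)" by blast
  define u v where "u = (\<lambda>n. fst (f n))" and "v = (\<lambda>n. snd (f n))"
  have uv: "u n \<prec> v n" "projective (u n, v n) (x, y)" "v (Suc n) \<le> u n" for n
    using f[of n] by (simp_all add: u_def v_def)
  then have "v (Suc n) \<le> v n" for n
    by (meson covered_by_def less_imp_le order_trans)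
  then have "v n \<le> u m" if "m < n" for m n
    using lift_Suc_antimono_le[of v "Suc m" n] that uv(3)[of m] by (simp add: order_trans)
  with uv show ?thesis by (intro infinite_ladder_sequence[of u v]) auto
qed

lemma infinite_ladder_ascending:
  assumes "W w"
    and step: "\<And>w. W w \<Longrightarrow> \<exists>u v. u \<prec> v \<and> projective (u, v) (x, y) \<and> w \<le> u \<and> W v"
  shows "\<exists>Q. covering_ladder x y Q \<and> infinite Q"
proof -
  let ?P = "\<lambda>p. fst p \<prec> snd p \<and> projective p (x, y) \<and> W (snd p)"
  have "\<exists>f. \<forall>n. ?P (f n) \<and> snd (f n) \<le> fst (f (Suc n))"
    by (rule dependent_nat_choice) (use step \<open>W w\<close> in \<open>fastforce+\<close>)
  then obtain f where f: "\<And>n. ?P (f n)" "\<And>n. snd (f n) \<le> fst (f (Suc n))" by blast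
  define u v where "u = (\<lambda>n. fst (f n))" and "v = (\<lambda>n. snd (f n))"
  have uv: "u n \<prec> v n" "projective (u n, v n) (x, y)" "v n \<le> u (Suc n)" for n
    using f[of n] by (simp_all add: u_def v_def)
  then have "u n \<le> u (Suc n)" for n
    by (meson covered_by_def less_imp_le order_trans)
  then have "v m \<le> u n" if "m < n" for m n
    using lift_Suc_mono_le[of u "Suc m" n] that uv(3)[of m] by (auto intro: order_trans)
  with uv show ?thesis by (intro infinite_ladder_sequence[of u v]) auto
qed

section \<open>From ladders of filters to ladders of elements\<close>

text \<open>Induction on the size, removing the lowest covering \<open>(F0, G0)\<close>. The others
  lie above \<open>G0\<close>, so they can be replaced by coverings above some member
  \<open>w\<close> of \<open>G0\<close>, and then \<open>(F0, G0)\<close> by one below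
  \<open>w\<close>. The bound \<open>B\<close> carries this information through the
  induction.\<close>

lemma finite_ladder_of_filters:
  fixes x y :: "'a::modular_lattice"
  assumes xy: "x \<prec> y"
    and "covering_ladder (Fg x) (Fg y) S" "finite S" "\<And>F G. (F, G) \<in> S \<Longrightarrow> B \<le> F"
  obtains Q w where "covering_ladder x y Q" "finite Q" "card Q = card S"
    "B \<le> Fg w" "\<And>u v. (u, v) \<in> Q \<Longrightarrow> w \<le> u"
proof -
  have "\<exists>Q w. covering_ladder x y Q \<and> finite Q \<and> card Q = card S \<and>
      B \<le> Fg w \<and> (\<forall>(u, v)\<in>Q. w \<le> u)"
    using assms(2-)
  proof (induction "card S" arbitrary: S B)
    case 0
    obtain w where "B \<le> Fg w" using ex_Fg_ge by blast
    with 0 show ?case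
      by (intro exI[of _ "{}"] exI[of _ w]) (simp add: covering_ladder_def)
  next
    case (Suc n)
    then have "fst ` S \<noteq> {}" "finite (fst ` S)" by auto
    then obtain F0 where "F0 \<in> fst ` S" and min0: "\<And>F. F \<in> fst ` S \<Longrightarrow> F \<le> F0 \<Longrightarrow> F = F0"
      by (metis finite_has_minimal)
    then obtain G0 where s0: "(F0, G0) \<in> S" by auto
    let ?S = "S - {(F0, G0)}"
    have G0: "G0 \<le> F" if "(F, G) \<in> ?S" for F G
    proof (rule ccontr)
      assume "\<not> G0 \<le> F"
      moreover have FG: "F < G"
        using that covering_ladderD(1)[OF Suc.prems(1)] by (auto simp: covered_by_def)
      ultimately have "G \<le> F0"
        using that covering_ladder_linear[OF Suc.prems(1) s0, of F G] by auto
      then have "F < F0" using FG by simp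
      moreover have "F \<in> fst ` S" using that by force
      ultimately show False using min0[of F] by (simp add: less_le)
    qed
    have "n = card ?S" using Suc s0 by simp
    from Suc.hyps(1)[OF this covering_ladder_subset[OF Suc.prems(1)], of G0] G0 Suc.prems(2)
    obtain Q w where Q: "covering_ladder x y Q" "finite Q" "card Q = n"
      and w: "G0 \<le> Fg w" "\<forall>(u, v)\<in>Q. w \<le> u"
      using \<open>n = card ?S\<close> by fastforce
    from projective_Fg_principal[OF xy covering_ladderD(2)[OF Suc.prems(1) s0] w(1)]
    obtain u v where uv: "u \<prec> v" "projective (u, v) (x, y)" "(F0, G0) \<nearrow> (Fg u, Fg v)" "v \<le> w" .
    have le: "v \<le> u'" if "(u', v') \<in> Q" for u' v'
      using w(2) that uv(4) by (auto intro: order_trans)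
    have "\<not> v \<le> u" using uv(1) by (auto simp: covered_by_def)
    then have "(u, v) \<notin> Q" using le by blast
    moreover have "covering_ladder x y (insert (u, v) Q)"
      using Q(1) uv(1,2) le unfolding covering_ladder_def by blast
    moreover have "u \<le> u'" if "(u', v') \<in> Q" for u' v'
      using le[OF that] uv(1) by (meson covered_by_def less_imp_le order_trans)
    moreover have "B \<le> Fg u"
      using Suc.prems(3)[OF s0] uv(3) by (metis inf_le2 order_trans transposes_up_iff)
    ultimately show ?case
      using Q(2,3) Suc.hyps(2)
      by (intro exI[of _ "insert (u, v) Q"] exI[of _ u]) auto
  qed
  then show ?thesis using that by blast
qed

text \<open>A pair collapsed by joining with \<open>Fg w\<close> survives meeting with it. The meet
  still lies above \<open>B\<close>, so the principal covering found below \<open>w\<close> has its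
  lower end in \<open>B\<close> and the construction repeats.\<close>

lemma infinite_ladder_below_filter:
  fixes x y :: "'a::modular_lattice"
  assumes xy: "x \<prec> y"
    and step: "\<And>w. B \<le> Fg w \<Longrightarrow> \<exists>F G. projective (F, G) (Fg x, Fg y) \<and> B \<le> F \<and> F \<le> G \<and>
      sup F (Fg w) = sup G (Fg w)"
  shows "\<exists>Q. covering_ladder x y Q \<and> infinite Q"
proof -
  obtain w0 where w0: "B \<le> Fg w0" using ex_Fg_ge by blast
  show ?thesis
  proof (rule infinite_ladder_descending[where W = "\<lambda>w. B \<le> Fg w", OF w0])
    fix w assume w: "B \<le> Fg w"
    from step[OF w] obtain F G where FG: "projective (F, G) (Fg x, Fg y)" "B \<le> F"
      and "F \<le> G" "sup F (Fg w) = sup G (Fg w)" by blast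
    from transposes_up_inf[OF this(3,4)] FG(1)
    have "projective (inf F (Fg w), inf G (Fg w)) (Fg x, Fg y)" by (rule projective_up)
    from projective_Fg_principal[OF xy this inf_le2]
    obtain u v where "u \<prec> v" "projective (u, v) (x, y)"
      and t: "(inf F (Fg w), inf G (Fg w)) \<nearrow> (Fg u, Fg v)" and "v \<le> w" .
    moreover have "B \<le> Fg u"
      using t FG(2) w by (metis transposes_up_iff inf_le2 le_inf_iff order_trans)
    ultimately show "\<exists>u v. u \<prec> v \<and> projective (u, v) (x, y) \<and> v \<le> w \<and> B \<le> Fg u" by blast
  qed
qed

text \<open>The lower end \<open>u\<close> of the covering replacing \<open>(F, G)\<close> belongs
  to \<open>F\<close>, hence to the upper filter of a pair of \<open>T\<close> below it, whose
  replacement can be chosen below \<open>u\<close>.\<close>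

lemma infinite_ladder_no_least:
  fixes x y :: "'a::modular_lattice"
  assumes xy: "x \<prec> y" and T: "\<And>F G. (F, G) \<in> T \<Longrightarrow> projective (F, G) (Fg x, Fg y)" "T \<noteq> {}"
    and no_least: "\<And>F G. (F, G) \<in> T \<Longrightarrow> \<exists>(F', G')\<in>T. G' \<le> F"
  shows "\<exists>Q. covering_ladder x y Q \<and> infinite Q"
proof -
  let ?W = "\<lambda>w. \<exists>(F, G)\<in>T. F \<le> Fg w"
  obtain w0 where w0: "?W w0" using \<open>T \<noteq> {}\<close> ex_Fg_ge by fast
  show ?thesis
  proof (rule infinite_ladder_descending[where W = ?W, OF w0])
    fix w assume "?W w"
    then obtain F G where "(F, G) \<in> T" "F \<le> Fg w" by blast
    with no_least obtain F' G' where FG: "(F', G') \<in> T" "G' \<le> F" by blast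
    from this(2) \<open>F \<le> Fg w\<close> have "G' \<le> Fg w" by (rule order_trans)
    from projective_Fg_principal[OF xy T(1)[OF FG(1)] this]
    obtain u v where "u \<prec> v" "projective (u, v) (x, y)"
      and t: "(F', G') \<nearrow> (Fg u, Fg v)" and "v \<le> w" .
    moreover have "F' \<le> Fg u" using t by (metis transposes_up_iff inf_le2)
    ultimately show "\<exists>u v. u \<prec> v \<and> projective (u, v) (x, y) \<and> v \<le> w \<and> ?W u"
      using FG(1) by blast
  qed
qed

lemma infinite_ladder_of_filters:
  fixes x y :: "'a::modular_lattice"
  assumes xy: "x \<prec> y" and S: "covering_ladder (Fg x) (Fg y) S" and inf: "infinite S"
  shows "\<exists>Q. covering_ladder x y Q \<and> infinite Q"
proof (cases "\<forall>T\<subseteq>S. T \<noteq> {} \<longrightarrow> (\<exists>(F0, G0)\<in>T. \<forall>(F, G)\<in>T. (F, G) = (F0, G0) \<or> G0 \<le> F)")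
  case False
  then obtain T where T: "T \<subseteq> S" "T \<noteq> {}"
    and no: "\<not> (\<exists>(F0, G0)\<in>T. \<forall>(F, G)\<in>T. (F, G) = (F0, G0) \<or> G0 \<le> F)" by blast
  show ?thesis
  proof (rule infinite_ladder_no_least[OF xy _ T(2)])
    fix F G assume FG: "(F, G) \<in> T"
    then show "projective (F, G) (Fg x, Fg y)" using T(1) covering_ladderD(2)[OF S] by blast
    from FG no obtain F' G' where *: "(F', G') \<in> T" "(F', G') \<noteq> (F, G)" "\<not> G \<le> F'" by blast
    with FG T(1) covering_ladder_linear[OF S, of F' G' F G] have "G' \<le> F" by blast
    with * show "\<exists>(F', G')\<in>T. G' \<le> F" by blast
  qed
next
  case True
  \<comment> \<open>\<open>J w\<close> consists of the coverings that survive joining with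
    \<open>Fg w\<close>; it can only shrink as \<open>w\<close> grows.\<close>
  define J where "J w = {(F, G)\<in>S. sup F (Fg w) \<noteq> sup G (Fg w)}" for w
  have J_anti: "J w \<subseteq> J v" if "v \<le> w" for v w
  proof -
    have "sup H (Fg w) = sup (sup H (Fg v)) (Fg w)" for H
      using that by (metis Fg_le_iff sup.absorb2 sup_assoc)
    then show ?thesis unfolding J_def by (smt (verit, best) Collect_mono case_prod_beta')
  qed
  have le: "F \<le> G" if "(F, G) \<in> S" for F G
    using covering_ladderD(1)[OF S that] by (simp add: covered_by_def less_imp_le)
  \<comment> \<open>If some \<open>J v\<close> is infinite, either one such \<open>v\<close> has no
    covering above it, projective to \<open>(x, y)\<close>, whose top keeps \<open>J\<close>
    infinite, or every such \<open>v\<close> has one.\<close>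
  consider (none) "\<And>w. finite (J w)"
    | (max) v where "infinite (J v)"
        "\<And>u w. v \<le> u \<Longrightarrow> u \<prec> w \<Longrightarrow> projective (u, w) (x, y) \<Longrightarrow> finite (J w)"
    | (ascend) w where "infinite (J w)"
        "\<And>v. infinite (J v) \<Longrightarrow> \<exists>u w. u \<prec> w \<and> projective (u, w) (x, y) \<and> v \<le> u \<and> infinite (J w)"
    by metis
  then show ?thesis
  proof cases
    case none
    from True inf obtain F0 G0 where least: "\<forall>(F, G)\<in>S. (F, G) = (F0, G0) \<or> G0 \<le> F"
      by (metis (no_types, lifting) case_prodE finite.emptyI order_refl)
    show ?thesis
    \<comment> \<open>Apart from the lowest covering, all of \<open>S\<close> lies above
      \<open>G0\<close>, and each \<open>w\<close> collapses all but finitely many of them.\<close>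
    proof (rule infinite_ladder_below_filter[OF xy, of G0])
      fix w
      have "infinite (S - insert (F0, G0) (J w))" using inf none by simp
      then obtain F G where "(F, G) \<in> S - insert (F0, G0) (J w)"
        by (metis ex_in_conv finite.emptyI surj_pair)
      then have FG: "(F, G) \<in> S" "(F, G) \<noteq> (F0, G0)" "(F, G) \<notin> J w" by auto
      then have "G0 \<le> F" "sup F (Fg w) = sup G (Fg w)"
        using least by (blast, simp add: J_def)
      with le[OF FG(1)] covering_ladderD(2)[OF S FG(1)]
      show "\<exists>F G. projective (F, G) (Fg x, Fg y) \<and> G0 \<le> F \<and> F \<le> G \<and>
          sup F (Fg w) = sup G (Fg w)"
        by blast
    qed
  next
    case (max v)
    have "J v \<subseteq> S" "J v \<noteq> {}" using max(1) by (force simp: J_def, force)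
    with True obtain F0 G0 where s0: "(F0, G0) \<in> J v"
      and least: "\<forall>(F, G)\<in>J v. (F, G) = (F0, G0) \<or> G0 \<le> F"
      by (metis (no_types, lifting) case_prodE)
    have proj: "projective (sup F (Fg v), sup G (Fg v)) (Fg x, Fg y)" if "(F, G) \<in> J v" for F G
      using that covering_ladderD[OF S, of F G] covered_by_transposes_up_sup projective_down
      unfolding J_def by blast
    show ?thesis
    \<comment> \<open>Every member \<open>w\<close> of this filter lies above the top
      \<open>v'\<close> of a covering above \<open>v\<close>. By the choice of \<open>v\<close> the
      set \<open>J v'\<close> is finite, hence so is \<open>J w\<close>, and infinitely many members
      of \<open>J v\<close> are collapsed by \<open>w\<close>.\<close>
    proof (rule infinite_ladder_below_filter[OF xy, of "sup G0 (Fg v)"])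
      fix w assume w: "sup G0 (Fg v) \<le> Fg w"
      from projective_Fg_principal[OF xy proj[OF s0] w]
      obtain u' v' where uv: "u' \<prec> v'" "projective (u', v') (x, y)"
        and t: "(sup F0 (Fg v), sup G0 (Fg v)) \<nearrow> (Fg u', Fg v')" and "v' \<le> w" .
      have "sup F0 (Fg v) \<le> Fg u'" using t by (metis transposes_up_iff inf_le2)
      then have "v \<le> u'" by (simp add: Fg_le_iff)
      with uv max(2) have "finite (J v')" by blast
      with J_anti[OF \<open>v' \<le> w\<close>] have "finite (J w)" by (rule finite_subset)
      then have "infinite (J v - insert (F0, G0) (J w))" using max(1) by simp
      then obtain F G where "(F, G) \<in> J v - insert (F0, G0) (J w)"
        by (metis ex_in_conv finite.emptyI surj_pair)
      then have FG: "(F, G) \<in> J v" "(F, G) \<noteq> (F0, G0)" "(F, G) \<notin> J w" by auto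
      have "(F, G) \<in> S" using FG(1) by (simp add: J_def)
      have "Fg v \<le> Fg w" using w by simp
      then have "sup (sup H (Fg v)) (Fg w) = sup H (Fg w)" for H
        by (simp add: sup_assoc sup.absorb2)
      then have "sup (sup F (Fg v)) (Fg w) = sup (sup G (Fg v)) (Fg w)"
        using FG(3) \<open>(F, G) \<in> S\<close> by (simp add: J_def)
      moreover have "sup F (Fg v) \<le> sup G (Fg v)" "sup G0 (Fg v) \<le> sup F (Fg v)"
        using le[OF \<open>(F, G) \<in> S\<close>] least FG by (auto intro: sup_mono le_supI1)
      ultimately show "\<exists>F G. projective (F, G) (Fg x, Fg y) \<and> sup G0 (Fg v) \<le> F \<and> F \<le> G \<and>
          sup F (Fg w) = sup G (Fg w)"
        using proj[OF FG(1)] by blast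
    qed
  next
    case (ascend w)
    show ?thesis
      by (rule infinite_ladder_ascending[where W = "\<lambda>w. infinite (J w)", OF ascend])
  qed
qed

section \<open>Comparison of the two multiplicity bounds\<close>

theorem theorem19:
  fixes x y :: "'a::modular_lattice"
  assumes "x \<prec> y"
  shows "mult_upper_bound x y \<le>o mult_upper_bound (Fg x) (Fg y) \<and>
    (finite (Field (mult_upper_bound x y)) \<or> mult_upper_bound x y =o natLeq \<longrightarrow>
      mult_upper_bound x y =o mult_upper_bound (Fg x) (Fg y)) \<and>
    (infinite (Field (mult_upper_bound x y)) \<longrightarrow>
      infinite (Field (mult_upper_bound (Fg x) (Fg y))))"
proof (intro conjI impI)
  let ?\<nu> = "mult_upper_bound x y" and ?\<phi> = "mult_upper_bound (Fg x) (Fg y)"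
  have xy: "x \<le> y" using assms by (simp add: covered_by_def less_imp_le)
  have co: "Card_order ?\<nu>" by (rule Card_order_mult_upper_bound)
  have Q_less: "|Q| <o ?\<nu>" if "covering_ladder x y Q" for Q
    using that mult_upper_bound_props[of x y] by (simp add: bounds_multiplicity_iff_ladder)
  have "|Q| <o ?\<phi>" if "covering_ladder x y Q" for Q
  proof -
    have "|Q| =o |map_prod Fg Fg ` Q|"
      by (rule card_of_ordIsoI[of "map_prod Fg Fg"])
        (meson inj_Fg inj_on_imp_bij_betw inj_on_subset prod.inj_map subset_UNIV)
    moreover have "|map_prod Fg Fg ` Q| <o ?\<phi>"
      using mult_upper_bound_props[of "Fg x" "Fg y"] Fg_covering_ladder[OF that xy]
      by (simp add: bounds_multiplicity_iff_ladder)
    ultimately show ?thesis by (rule ordIso_ordLess_trans)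
  qed
  then show le: "?\<nu> \<le>o ?\<phi>"
    by (simp add: mult_upper_bound_ordLeq_iff Card_order_mult_upper_bound
        bounds_multiplicity_iff_ladder)
  then show "infinite (Field ?\<phi>)" if "infinite (Field ?\<nu>)"
    using that card_of_mono2 card_of_ordLeq_finite by blast
  assume small: "finite (Field ?\<nu>) \<or> ?\<nu> =o natLeq"
  \<comment> \<open>This makes \<open>?\<nu>\<close> a bound for the filter side; leastness of
    \<open>?\<phi>\<close> applies although the two cardinals live on different types.\<close>
  have "|S| <o ?\<nu>" if S: "covering_ladder (Fg x) (Fg y) S" for S
    using small
  proof
    assume fin: "finite (Field ?\<nu>)"
    show ?thesis
    proof (rule ccontr)
      assume "\<not> |S| <o ?\<nu>"
      then have "?\<nu> \<le>o |S|"
        using co card_of_Well_order by (metis card_order_on_def ordLess_or_ordLeq)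
      then have "|Field ?\<nu>| \<le>o |S|"
        using card_of_Field_ordIso[OF co] ordIso_ordLeq_trans by blast
      then obtain h where h: "inj_on h (Field ?\<nu>)" "h ` Field ?\<nu> \<subseteq> S"
        using card_of_ordLeq by metis
      \<comment> \<open>A subladder of size exactly \<open>?\<nu>\<close>: its replacement by
        elements would be a ladder that \<open>?\<nu>\<close> fails to bound.\<close>
      let ?T = "h ` Field ?\<nu>"
      obtain z where z: "\<And>F G. (F, G) \<in> ?T \<Longrightarrow> z \<le> F"
      proof -
        have "\<exists>z. \<forall>a\<in>fst ` ?T. z \<le> a"
          using finite_imageI[OF finite_imageI[OF fin, of h], of fst]
          by (induction rule: finite_induct) (auto intro: le_infI1 le_infI2 dest: inf.coboundedI2)
        then obtain z where "\<forall>a\<in>fst ` ?T. z \<le> a" by blast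
        then show ?thesis by (metis that fst_conv imageI)
      qed
      obtain Q where Q: "covering_ladder x y Q" "finite Q" "card Q = card ?T"
        using finite_ladder_of_filters[OF assms covering_ladder_subset[OF S h(2)] finite_imageI[OF fin]] z
        by metis
      have "card ?T = card (Field ?\<nu>)" by (rule card_image[OF h(1)])
      then have "|Q| =o |Field ?\<nu>|"
        using Q fin by (metis finite_same_card_bij card_of_ordIsoI)
      then have "|Q| =o ?\<nu>"
        using card_of_Field_ordIso[OF co] ordIso_transitive by blast
      with Q_less[OF Q(1)] show False
        using not_ordLess_ordIso by blast
    qed
  next
    assume nat: "?\<nu> =o natLeq"
    \<comment> \<open>For \<open>natLeq\<close>, being bounded means that every ladder is finite, so
      an infinite ladder of filters would yield a contradiction.\<close>
    have "finite Q" if "covering_ladder x y Q" for Q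
      using ordLess_ordIso_trans[OF Q_less[OF that] nat] finite_iff_ordLess_natLeq by blast
    then have "finite S" using infinite_ladder_of_filters[OF assms S] by blast
    then have "|S| <o natLeq" using finite_iff_ordLess_natLeq by blast
    then show ?thesis using nat ordIso_symmetric ordLess_ordIso_trans by blast
  qed
  then have "?\<phi> \<le>o ?\<nu>"
    using co by (simp add: mult_upper_bound_ordLeq_iff bounds_multiplicity_iff_ladder)
  with le show "?\<nu> =o ?\<phi>" by (simp add: ordIso_iff_ordLeq)
qed

end
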